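(* None of the measure-dimension mappings $$\dim_B^L,\ \overline{\dim}_B^L,\ \underline{\dim}_B^L,\ \overline{\dim}_{MB}^L,\ \underline{\dim}_{MB}^L,\ \dim_H^L,\ \dim_P^L,$$ $$\dim_B^U,\ \overline{\dim}_B^U,\ \underline{\dim}_B^U,\ \overline{\dim}_{MB}^U,\ \underline{\dim}_{MB}^U,\ \dim_H^U,\ \dim_P^U,\qquad \dim_C,\ \dim_{MC}$$ on $\mathcal{M}(X)$ is, in general, continuous under the weak, the setwise or the TV topology. That is: for each mapping $D$ in this list and each of the three topologies (weak, setwise, TV) there is a metric space $X$ such that $D$ (on the subset of $\mathcal{M}(X)$ where it is defined) is not continuous with respect to that topology.
   Context: Let $(X,\rho)$ be a metric space, $\mathcal{B}$ its Borel $\sigma$-algebra, $\mathcal{M}(X)$ the collection of all Borel measures on $X$. $B(x,r)$ is the ball of radius $r$ about $x$. Set dimensions: $\dim_H$ and $\dim_P$ are Hausdorff and packing dimension. $\overline{\dim}_B,\underline{\dim}_B$ are upper and lower box-counting dimension, and $\dim_B(A)$ is their common value when they coincide. The upper modified box-counting dimension is $\overline{\dim}_{MB}(A)=\inf\{\sup_i\overline{\dim}_B(A_i): A\subset\bigcup_{i=1}^\infty A_i\}$, the infimum being over countable covers of $A$ by bounded sets; $\underline{\dim}_{MB}$ is defined in the same way from $\underline{\dim}_B$. For a set dimension $\dim$, the induced lower and upper measure-dimension mappings are $\dim^L(\nu)=\inf\{\dim(A):A\in\mathcal{B},\ \nu(A)>0\}$ and $\dim^U(\nu)=\inf\{\dim(A):A\in\mathcal{B},\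 \nu(X\setminus A)=0\}$ (for $\dim_B$ the infimum runs over those $A$ for which $\dim_B(A)$ exists). Super/subscripts are carried over, e.g. $\dim_H^L,\dim_H^U$. Correlation dimension: $\dim_C(\nu)=\lim_{r\to0}\frac{\log\int\nu(B(x,r))\,d\nu(x)}{\log r}$, when the limit exists. Modified correlation dimension: $\dim_{MC}(\nu)=\lim_{\delta\to0}\ \sup_{\{A\in\mathcal{B}:\ \nu(A)\ge1-\delta\}}\ \lim_{r\to0}\frac{\log\int_A\nu(B(x,r))\,d\nu(x)}{\log r}$, when the limit exists. The weak (resp. setwise) topology on $\mathcal{M}(X)$ is generated by the sets $\{\varrho: |\int f\,d\varrho-\int f\,d\nu|<\epsilon\}$, $\nu\in\mathcal{M}(X)$, $\epsilon>0$, $f:X\to\mathbb{R}$ bounded continuous (resp. bounded measurable). The TV topology is induced by $\|\nu-\varrho\|_{TV}=\sup_{A\in\mathcal{B}}|\nu(A)-\varrho(A)|$. *)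

theory Defs
  imports "HOL-Analysis.Analysis"
begin

section \<open>Borel measures and the three topologies\<close>

definition metric_borel :: "'a metric \<Rightarrow> 'a measure" where
  "metric_borel m = sigma (mspace m) {U. openin (mtopology_of m) U}"

text \<open>The measures are finite: otherwise neither the integrals of bounded functions nor the
  differences in the total variation distance are defined.\<close>

definition borel_measures :: "'a metric \<Rightarrow> 'a measure set" where
  "borel_measures m = {\<nu>. sets \<nu> = sets (metric_borel m) \<and> finite_measure \<nu>}"

definition integral_nbhd ::
  "'a metric \<Rightarrow> 'a measure \<Rightarrow> real \<Rightarrow> ('a \<Rightarrow> real) \<Rightarrow> 'a measure set" where
  "integral_nbhd m \<nu> \<epsilon> f =
     {\<rho> \<in> borel_measures m. \<bar>(LINT x|\<rho>. f x) - (LINT x|\<nu>. f x)\<bar> < \<epsilon>}"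

definition weak_topology :: "'a metric \<Rightarrow> 'a measure topology" where
  "weak_topology m = topology_generated_by
     {integral_nbhd m \<nu> \<epsilon> f | \<nu> \<epsilon> f. \<nu> \<in> borel_measures m \<and> 0 < \<epsilon> \<and>
        continuous_map (mtopology_of m) euclideanreal f \<and> bounded (f ` mspace m)}"

definition setwise_topology :: "'a metric \<Rightarrow> 'a measure topology" where
  "setwise_topology m = topology_generated_by
     {integral_nbhd m \<nu> \<epsilon> f | \<nu> \<epsilon> f. \<nu> \<in> borel_measures m \<and> 0 < \<epsilon> \<and>
        f \<in> borel_measurable (metric_borel m) \<and> bounded (f ` mspace m)}"

text \<open>The supremum is taken in \<open>ennreal\<close> so that the distance is non-negative for all arguments, as
  \<open>Metric_space\<close> requires. It is finite on \<open>borel_measures m\<close>.\<close>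

definition tv_dist :: "'a metric \<Rightarrow> 'a measure \<Rightarrow> 'a measure \<Rightarrow> real" where
  "tv_dist m \<nu> \<rho> =
     enn2real (SUP A\<in>sets (metric_borel m). ennreal \<bar>measure \<nu> A - measure \<rho> A\<bar>)"

definition tv_topology :: "'a metric \<Rightarrow> 'a measure topology" where
  "tv_topology m = Metric_space.mtopology (borel_measures m) (tv_dist m)"

lemma ennreal_tv_dist:
  assumes "\<nu> \<in> borel_measures m" "\<rho> \<in> borel_measures m"
  shows "ennreal (tv_dist m \<nu> \<rho>) =
           (SUP A\<in>sets (metric_borel m). ennreal \<bar>measure \<nu> A - measure \<rho> A\<bar>)"
proof -
  interpret N: finite_measure \<nu> using assms by (simp add: borel_measures_def)
  interpret R: finite_measure \<rho> using assms by (simp add: borel_measures_def)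
  let ?c = "measure \<nu> (space \<nu>) + measure \<rho> (space \<rho>)"
  have "\<bar>measure \<nu> A - measure \<rho> A\<bar> \<le> ?c" for A
    using N.bounded_measure[of A] R.bounded_measure[of A]
      measure_nonneg[of \<nu> A] measure_nonneg[of \<rho> A] by linarith
  then have "(SUP A\<in>sets (metric_borel m). ennreal \<bar>measure \<nu> A - measure \<rho> A\<bar>) \<le> ennreal ?c"
    by (intro SUP_least ennreal_leI)
  then show ?thesis
    unfolding tv_dist_def by (intro ennreal_enn2real) (auto intro: le_less_trans)
qed

lemma tv_dist_upper:
  assumes "\<nu> \<in> borel_measures m" "\<rho> \<in> borel_measures m" "A \<in> sets (metric_borel m)"
  shows "\<bar>measure \<nu> A - measure \<rho> A\<bar> \<le> tv_dist m \<nu> \<rho>"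
proof -
  have "ennreal \<bar>measure \<nu> A - measure \<rho> A\<bar> \<le> ennreal (tv_dist m \<nu> \<rho>)"
    unfolding ennreal_tv_dist[OF assms(1,2)] by (rule SUP_upper[OF assms(3)])
  then show ?thesis
    by (simp add: tv_dist_def)
qed

lemma tv_dist_least:
  assumes "\<nu> \<in> borel_measures m" "\<rho> \<in> borel_measures m" "0 \<le> c"
    and "\<And>A. A \<in> sets (metric_borel m) \<Longrightarrow> \<bar>measure \<nu> A - measure \<rho> A\<bar> \<le> c"
  shows "tv_dist m \<nu> \<rho> \<le> c"
proof -
  have "ennreal (tv_dist m \<nu> \<rho>) \<le> ennreal c"
    unfolding ennreal_tv_dist[OF assms(1,2)] using assms(4) by (intro SUP_least ennreal_leI)
  then show ?thesis
    using assms(3) by simp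
qed

lemma Metric_space_tv_dist: "Metric_space (borel_measures m) (tv_dist m)"
proof
  fix \<nu> \<rho> :: "'a measure"
  show nonneg: "0 \<le> tv_dist m \<nu> \<rho>"
    by (simp add: tv_dist_def)
  show "tv_dist m \<nu> \<rho> = tv_dist m \<rho> \<nu>"
    by (simp add: tv_dist_def abs_minus_commute)
  assume N: "\<nu> \<in> borel_measures m" and R: "\<rho> \<in> borel_measures m"
  show "tv_dist m \<nu> \<rho> = 0 \<longleftrightarrow> \<nu> = \<rho>"
  proof
    assume 0: "tv_dist m \<nu> \<rho> = 0"
    interpret N: finite_measure \<nu> using N by (simp add: borel_measures_def)
    interpret R: finite_measure \<rho> using R by (simp add: borel_measures_def)
    show "\<nu> = \<rho>"
    proof (rule measure_eqI)
      show "sets \<nu> = sets \<rho>"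
        using N R by (simp add: borel_measures_def)
      fix A assume "A \<in> sets \<nu>"
      then have "measure \<nu> A = measure \<rho> A"
        using tv_dist_upper[OF N R, of A] 0 N by (simp add: borel_measures_def)
      then show "emeasure \<nu> A = emeasure \<rho> A"
        by (simp add: N.emeasure_eq_measure R.emeasure_eq_measure)
    qed
  next
    assume "\<nu> = \<rho>"
    then show "tv_dist m \<nu> \<rho> = 0"
      using tv_dist_least[OF N R, of 0] nonneg by simp
  qed
  fix \<sigma> assume S: "\<sigma> \<in> borel_measures m"
  have nn: "0 \<le> tv_dist m \<nu> \<rho>" "0 \<le> tv_dist m \<rho> \<sigma>"
    by (simp_all add: tv_dist_def)
  show "tv_dist m \<nu> \<sigma> \<le> tv_dist m \<nu> \<rho> + tv_dist m \<rho> \<sigma>"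
  proof (rule tv_dist_least[OF N S])
    fix A assume A: "A \<in> sets (metric_borel m)"
    show "\<bar>measure \<nu> A - measure \<sigma> A\<bar> \<le> tv_dist m \<nu> \<rho> + tv_dist m \<rho> \<sigma>"
      using tv_dist_upper[OF N R A] tv_dist_upper[OF R S A] by linarith
  qed (use nn in simp)
qed

section \<open>Dimensions of sets\<close>

definition elog :: "ereal \<Rightarrow> ereal" where
  "elog t = (if t \<le> 0 then -\<infinity> else if t = \<infinity> then \<infinity> else ereal (ln (real_of_ereal t)))"

definition ediam :: "'a metric \<Rightarrow> 'a set \<Rightarrow> ennreal" where
  "ediam m U = (SUP x\<in>U. SUP y\<in>U. ennreal (mdist m x y))"

definition covering_number :: "'a metric \<Rightarrow> 'a set \<Rightarrow> real \<Rightarrow> enat" where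
  "covering_number m A r =
     (INF C\<in>{C. finite C \<and> (\<forall>U\<in>C. U \<subseteq> mspace m \<and> ediam m U \<le> ennreal r) \<and> A \<subseteq> \<Union>C}. enat (card C))"

text \<open>The box-counting dimensions are \<open>\<infinity>\<close> for sets that are not totally bounded, and
  \<open>-\<infinity>\<close> for the empty set. The latter has no influence on the dimensions of non-zero measures.\<close>

definition upper_box_dim :: "'a metric \<Rightarrow> 'a set \<Rightarrow> ereal" where
  "upper_box_dim m A =
     Limsup (at_right 0) (\<lambda>r. elog (ereal_of_enat (covering_number m A r)) / ereal (- ln r))"

definition lower_box_dim :: "'a metric \<Rightarrow> 'a set \<Rightarrow> ereal" where
  "lower_box_dim m A =
     Liminf (at_right 0) (\<lambda>r. elog (ereal_of_enat (covering_number m A r)) / ereal (- ln r))"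

definition box_dim :: "'a metric \<Rightarrow> 'a set \<Rightarrow> ereal option" where
  "box_dim m A =
     (if lower_box_dim m A = upper_box_dim m A then Some (upper_box_dim m A) else None)"

definition bounded_covers :: "'a metric \<Rightarrow> 'a set \<Rightarrow> (nat \<Rightarrow> 'a set) set" where
  "bounded_covers m A = {E. (\<forall>i. Metric_space.mbounded (mspace m) (mdist m) (E i)) \<and> A \<subseteq> (\<Union>i. E i)}"

definition upper_mbox_dim :: "'a metric \<Rightarrow> 'a set \<Rightarrow> ereal" where
  "upper_mbox_dim m A = (INF E\<in>bounded_covers m A. SUP i. upper_box_dim m (E i))"

definition lower_mbox_dim :: "'a metric \<Rightarrow> 'a set \<Rightarrow> ereal" where
  "lower_mbox_dim m A = (INF E\<in>bounded_covers m A. SUP i. lower_box_dim m (E i))"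

definition hausdorff_content ::
  "'a metric \<Rightarrow> real \<Rightarrow> real \<Rightarrow> 'a set \<Rightarrow> ennreal" where
  "hausdorff_content m s \<delta> A =
     (INF U\<in>{U :: nat \<Rightarrow> 'a set. (\<forall>i. U i \<subseteq> mspace m \<and> ediam m (U i) \<le> ennreal \<delta>) \<and> A \<subseteq> (\<Union>i. U i)}.
        \<Sum>i. ennreal (enn2real (ediam m (U i)) powr s))"

definition hausdorff_measure ::
  "'a metric \<Rightarrow> real \<Rightarrow> 'a set \<Rightarrow> ennreal" where
  "hausdorff_measure m s A = (SUP \<delta>\<in>{0<..}. hausdorff_content m s \<delta> A)"

text \<open>The exponent \<open>s = 0\<close> is left out here and for the packing dimension. This does not change the
  infimum, and it avoids \<open>0 powr 0 = 0\<close>.\<close>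

definition hausdorff_dim :: "'a metric \<Rightarrow> 'a set \<Rightarrow> ereal" where
  "hausdorff_dim m A = (INF s\<in>{s. 0 < s \<and> hausdorff_measure m s A = 0}. ereal s)"

text \<open>A packing of \<open>A\<close> is a family of pairwise disjoint closed balls centred in \<open>A\<close>, given by pairs of
  centre and radius because a ball does not determine them. Finite packings suffice, since the sum
  over a countable one is the supremum of its finite subsums.\<close>

definition packings ::
  "'a metric \<Rightarrow> real \<Rightarrow> 'a set \<Rightarrow> ('a \<times> real) set set" where
  "packings m \<delta> A = {C. finite C \<and> C \<subseteq> A \<times> {0<..\<delta>} \<and>
     pairwise (\<lambda>(x, r) (y, t).
       disjnt (mcball_of m x r) (mcball_of m y t)) C}"

definition packing_premeasure ::
  "'a metric \<Rightarrow> real \<Rightarrow> 'a set \<Rightarrow> ennreal" where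
  "packing_premeasure m s A =
     (INF \<delta>\<in>{0<..}. SUP C\<in>packings m \<delta> A. \<Sum>(x, r)\<in>C. ennreal ((2 * r) powr s))"

definition packing_measure ::
  "'a metric \<Rightarrow> real \<Rightarrow> 'a set \<Rightarrow> ennreal" where
  "packing_measure m s A =
     (INF E\<in>{E :: nat \<Rightarrow> 'a set. (\<forall>i. E i \<subseteq> mspace m) \<and> A \<subseteq> (\<Union>i. E i)}.
        \<Sum>i. packing_premeasure m s (E i))"

definition packing_dim :: "'a metric \<Rightarrow> 'a set \<Rightarrow> ereal" where
  "packing_dim m A = (INF s\<in>{s. 0 < s \<and> packing_measure m s A = 0}. ereal s)"

section \<open>Dimensions of measures\<close>

text \<open>A dimension of sets or measures has the value \<open>None\<close> where it is not defined.\<close>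

definition everywhere ::
  "('a metric \<Rightarrow> 'a set \<Rightarrow> ereal)
     \<Rightarrow> 'a metric \<Rightarrow> 'a set \<Rightarrow> ereal option" where
  "everywhere dm m A = Some (dm m A)"

definition inf_option :: "ereal set \<Rightarrow> ereal option" where
  "inf_option S = (if S = {} then None else Some (Inf S))"

definition lower_measure_dim ::
  "('a metric \<Rightarrow> 'a set \<Rightarrow> ereal option)
     \<Rightarrow> 'a metric \<Rightarrow> 'a measure \<Rightarrow> ereal option" where
  "lower_measure_dim dm m \<nu> = inf_option
     {t. \<exists>A\<in>sets (metric_borel m). 0 < emeasure \<nu> A \<and> dm m A = Some t}"

definition upper_measure_dim ::
  "('a metric \<Rightarrow> 'a set \<Rightarrow> ereal option)
     \<Rightarrow> 'a metric \<Rightarrow> 'a measure \<Rightarrow> ereal option" where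
  "upper_measure_dim dm m \<nu> = inf_option
     {t. \<exists>A\<in>sets (metric_borel m). emeasure \<nu> (mspace m - A) = 0 \<and> dm m A = Some t}"

definition lim_option :: "(real \<Rightarrow> ereal) \<Rightarrow> ereal option" where
  "lim_option g =
     (if \<exists>l. (g \<longlongrightarrow> l) (at_right 0) then Some (Lim (at_right 0) g) else None)"

definition corr_dim_on ::
  "'a metric \<Rightarrow> 'a measure \<Rightarrow> 'a set \<Rightarrow> ereal option" where
  "corr_dim_on m \<nu> A = lim_option (\<lambda>r.
     elog (ereal (LINT x:A|\<nu>. measure \<nu> (mball_of m x r))) / ereal (ln r))"

definition corr_dim ::
  "'a metric \<Rightarrow> 'a measure \<Rightarrow> ereal option" where
  "corr_dim m \<nu> = corr_dim_on m \<nu> (mspace m)"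

definition large_sets ::
  "'a metric \<Rightarrow> 'a measure \<Rightarrow> real \<Rightarrow> 'a set set" where
  "large_sets m \<nu> \<delta> = {A \<in> sets (metric_borel m). 1 - \<delta> \<le> measure \<nu> A}"

text \<open>The modified correlation dimension is defined if for all small \<open>\<delta>\<close> the supremum is over a
  non-empty family (which excludes measures of total mass less than 1), the limit in \<open>r\<close> exists for
  every member of the family, and the limit in \<open>\<delta>\<close> exists.\<close>

definition mod_corr_dim ::
  "'a metric \<Rightarrow> 'a measure \<Rightarrow> ereal option" where
  "mod_corr_dim m \<nu> =
     (if \<forall>\<^sub>F \<delta> in at_right 0. large_sets m \<nu> \<delta> \<noteq> {} \<and>
           (\<forall>A\<in>large_sets m \<nu> \<delta>. corr_dim_on m \<nu> A \<noteq> None)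
      then lim_option (\<lambda>\<delta>. SUP A\<in>large_sets m \<nu> \<delta>. the (corr_dim_on m \<nu> A))
      else None)"

text \<open>The zero measure is excluded, for which the dimensions are either undefined or a matter of
  convention about the empty set.\<close>

definition dim_domain ::
  "('a metric \<Rightarrow> 'a measure \<Rightarrow> ereal option)
     \<Rightarrow> 'a metric \<Rightarrow> 'a measure set" where
  "dim_domain D m = {\<nu> \<in> borel_measures m. emeasure \<nu> (mspace m) \<noteq> 0 \<and> D m \<nu> \<noteq> None}"

end

theory Submission
  imports Defs
begin

text \<open>All the dimensions jump between a point mass and length. On the line, let \<open>\<nu>\<^sub>t\<close> be obtained from
  length on \<open>[0, 1]\<close> by moving the part on \<open>[0, t]\<close> to the point 0 (this is \<open>collapsed t\<close>). For every
  measurable \<open>f\<close> with \<open>\<bar>f\<bar> \<le> K\<close>, the integrals of \<open>f\<close> with respect to \<open>\<nu>\<^sub>s\<close> and \<open>\<nu>\<^sub>t\<close> differ by at most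
  \<open>2 * K * \<bar>s - t\<bar>\<close> (\<open>integral_collapsed_Lipschitz\<close>). Hence \<open>t \<mapsto> \<nu>\<^sub>t\<close> is a continuous path in the
  total variation topology, and likewise in the setwise and the weak topology.

  A dimension \<open>D\<close> from the list is defined along the whole path and takes only values at most 0 or
  at least 1 on it, with \<open>D(\<nu>\<^sub>0) \<ge> 1\<close> and \<open>D(\<nu>\<^sub>1) \<le> 0\<close>. By the intermediate value theorem \<open>D\<close> is
  not continuous (\<open>jumps_along_collapsed_imp_discontinuous\<close>).

  For the dimensions induced by a dimension of sets, the values follow from two properties of the
  latter: it is at most 0 on \<open>{0}\<close>, and at least 1 on sets of positive length. A set of positive
  measure can be a single point as soon as there is an atom, so the lower dimensions are at most 0
  for \<open>t > 0\<close>; a set of full measure has positive length as long as \<open>t < 1\<close>, so the upper dimensions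
  are at least 1 for \<open>t < 1\<close>. That sets of positive length have dimension at least 1 rests on the
  inequality between length and diameter (\<open>emeasure_closure_le_ediam\<close>) and, for packings, on the fact
  that a largest packing turns into a cover when the radii are doubled
  (\<open>emeasure_closure_le_packing_premeasure\<close>).

  The integral that defines the correlation dimension is of order \<open>r\<close> for \<open>t = 0\<close>, and bounded below
  by \<open>t\<^sup>2\<close> for \<open>t > 0\<close>. The same holds for the modified version: since all \<open>\<nu>\<^sub>t\<close> have mass 1, sets
  of measure at least \<open>1 - \<delta>\<close> with \<open>\<delta> < t\<close> contain the atom.\<close>

abbreviation line :: "real metric" where
  "line \<equiv> euclidean_metric"

lemma sets_metric_borel_line [simp]: "sets (metric_borel line) = sets borel"
  by (simp add: metric_borel_def borel_def)

section \<open>Length and diameter on the line\<close>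

text \<open>On the line a set lies between its infimum and its supremum. The closure is taken because \<open>U\<close> may
  fail to be measurable; its diameter is the same. This one inequality is what makes length a lower
  bound for each way of measuring a set by coverings.\<close>
lemma emeasure_closure_le_ediam: "emeasure lborel (closure U) \<le> ediam line U"
proof (cases "U = {} \<or> ediam line U = top")
  case False
  then obtain d where d: "ediam line U = ennreal d" "0 \<le> d"
    by (cases "ediam line U") auto
  have dist: "dist x y \<le> d" if "x \<in> U" "y \<in> U" for x y
  proof -
    have "ennreal (dist x y) \<le> ediam line U"
      unfolding ediam_def by (rule SUP_upper2[OF that(1) SUP_upper2[OF that(2)]]) simp
    then show ?thesis using d by simp
  qed
  obtain a where a: "a \<in> U" using False by auto
  have bounds: "a - d \<le> x" "x \<le> a + d" if "x \<in> U" for x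
    using dist[OF a that] by (auto simp: dist_real_def)
  have below: "bdd_below U" and above: "bdd_above U"
    using bounds by (auto intro!: bdd_belowI bdd_aboveI)
  have "y - d \<le> Inf U" if "y \<in> U" for y
    using False dist that by (intro cInf_greatest) (force simp: dist_real_def)+
  then have "Sup U \<le> Inf U + d"
    using False by (intro cSup_least) (auto simp: algebra_simps)
  have "closure U \<subseteq> {Inf U..Sup U}"
    using below above by (intro closure_minimal) (auto intro: cInf_lower cSup_upper)
  then have "emeasure lborel (closure U) \<le> emeasure lborel {Inf U..Sup U}"
    by (intro emeasure_mono) auto
  also have "\<dots> \<le> ennreal d"
    using \<open>Sup U \<le> Inf U + d\<close> by (auto simp: emeasure_lborel_Icc_eq intro: ennreal_leI)
  finally show ?thesis using d by simp
qed auto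

lemma emeasure_le_suminf_closure:
  fixes E :: "nat \<Rightarrow> real set"
  assumes "A \<subseteq> (\<Union>i. E i)"
  shows "emeasure lborel A \<le> (\<Sum>i. emeasure lborel (closure (E i)))"
proof -
  have "A \<subseteq> (\<Union>i. closure (E i))"
    using assms closure_subset by blast
  then have "emeasure lborel A \<le> emeasure lborel (\<Union>i. closure (E i))"
    by (intro emeasure_mono) auto
  also have "\<dots> \<le> (\<Sum>i. emeasure lborel (closure (E i)))"
    by (intro emeasure_subadditive_countably) auto
  finally show ?thesis .
qed

section \<open>Box-counting dimensions\<close>

text \<open>A finite cover of \<open>A\<close> also covers its closure once each member is closed up.\<close>
lemma emeasure_closure_le_covering_number:
  assumes "covering_number line A r = enat n" "0 < r"
  shows "emeasure lborel (closure A) \<le> ennreal (real n * r)"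
proof -
  define S where
    "S = {C. finite C \<and> (\<forall>U\<in>C. U \<subseteq> mspace line \<and> ediam line U \<le> ennreal r) \<and> A \<subseteq> \<Union>C}"
  have Inf: "Inf ((\<lambda>C. enat (card C)) ` S) = enat n"
    using assms(1) by (simp only: covering_number_def S_def)
  have "(\<lambda>C. enat (card C)) ` S \<noteq> {}"
  proof
    assume "(\<lambda>C. enat (card C)) ` S = {}"
    then have "enat n = top" using Inf by (simp only: Inf_empty)
    then show False by (simp add: top_enat_def)
  qed
  then obtain k where "k \<in> (\<lambda>C. enat (card C)) ` S" by blast
  from wellorder_InfI[OF this] have "enat n \<in> (\<lambda>C. enat (card C)) ` S"
    by (simp only: Inf)
  then obtain C where "C \<in> S" and "card C = n" by auto
  then have C: "finite C" "\<And>U. U \<in> C \<Longrightarrow> ediam line U \<le> ennreal r" "A \<subseteq> \<Union>C" "card C = n"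
    by (auto simp: S_def)
  have "closure A \<subseteq> (\<Union>U\<in>C. closure U)"
    using C(1,3) closure_subset by (intro closure_minimal closed_UN) blast+
  then have "emeasure lborel (closure A) \<le> emeasure lborel (\<Union>U\<in>C. closure U)"
    using C(1) by (intro emeasure_mono) auto
  also have "\<dots> \<le> (\<Sum>U\<in>C. emeasure lborel (closure U))"
    using C(1) by (intro emeasure_subadditive_finite) auto
  also have "\<dots> \<le> (\<Sum>U\<in>C. ennreal r)"
    using C(2) emeasure_closure_le_ediam by (intro sum_mono) (blast intro: order_trans)
  also have "\<dots> = ennreal (real n * r)"
    using C(4) assms(2) by (simp add: ennreal_mult ennreal_of_nat_eq_real_of_nat)
  finally show ?thesis .
qed

text \<open>A set whose closure has length at least \<open>c > 0\<close> needs at least \<open>c / r\<close> sets of diameter \<open>r\<close>, so the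
  quotient that defines the dimension is at least \<open>1 - ln c / ln r\<close>, which tends to 1.\<close>
lemma lower_box_dim_ge_1:
  assumes "0 < emeasure lborel (closure A)"
  shows "1 \<le> lower_box_dim line A"
proof -
  obtain c where c: "0 < c" "ennreal c \<le> emeasure lborel (closure A)"
  proof (cases "emeasure lborel (closure A)")
    case (real x)
    then show ?thesis using assms that[of x] by simp
  next
    case top
    then show ?thesis using that[of 1] by simp
  qed
  define g where "g r = ereal (1 - ln c / ln r)" for r
  have "(g \<longlongrightarrow> ereal (1 - 0)) (at_right 0)"
    unfolding g_def
    by (intro tendsto_ereal tendsto_diff tendsto_const tendsto_divide_0[OF tendsto_const]
          filterlim_at_bot_imp_at_infinity ln_at_0)
  then have lim: "Liminf (at_right 0) g = 1"
    by (simp add: lim_imp_Liminf one_ereal_def)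
  have "\<forall>\<^sub>F r in at_right 0.
      g r \<le> elog (ereal_of_enat (covering_number line A r)) / ereal (- ln r)"
    using eventually_at_right_less[of 0] eventually_at_right_real[of 0 1, simplified]
  proof eventually_elim
    case (elim r)
    then have r: "0 < r" "r < 1" "ln r < 0" by auto
    show ?case
    proof (cases "covering_number line A r")
      case (enat n)
      have "ennreal c \<le> ennreal (real n * r)"
        using c(2) emeasure_closure_le_covering_number[OF enat r(1)] by (rule order_trans)
      then have *: "c \<le> real n * r"
        using r by (simp add: ennreal_le_iff)
      then have n: "0 < n" using c r by (cases n) auto
      have "ln c \<le> ln (real n * r)"
        using * c r n by (simp add: ln_le_cancel_iff)
      also have "\<dots> = ln (real n) + ln r"
        using n r by (simp add: ln_mult)
      finally have "- ln (real n) - ln r \<le> - ln c" by simp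
      then have "- ln c / ln r \<le> (- ln (real n) - ln r) / ln r"
        using r by (intro divide_right_mono_neg) auto
      then have "1 - ln c / ln r \<le> ln (real n) / (- ln r)"
        using r by (simp add: diff_divide_distrib)
      then show ?thesis
        using n r enat by (simp add: g_def elog_def)
    qed (use r in \<open>simp add: g_def elog_def ereal_divide\<close>)
  qed
  from Liminf_mono[OF this] show ?thesis
    unfolding lower_box_dim_def lim .
qed

lemma lower_le_upper_box_dim: "lower_box_dim m A \<le> upper_box_dim m A"
  unfolding lower_box_dim_def upper_box_dim_def by (rule Liminf_le_Limsup) simp

lemma covering_number_singleton:
  assumes "0 < r"
  shows "covering_number line {a} r = 1"
  unfolding covering_number_def
proof (rule antisym)
  let ?S = "{C. finite C \<and> (\<forall>U\<in>C. U \<subseteq> mspace line \<and> ediam line U \<le> ennreal r) \<and> {a} \<subseteq> \<Union>C}"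
  have "{{a}} \<in> ?S" by (simp add: ediam_def)
  then show "(INF C\<in>?S. enat (card C)) \<le> 1"
    by (rule INF_lower2) (simp add: one_enat_def)
  show "1 \<le> (INF C\<in>?S. enat (card C))"
  proof (rule INF_greatest)
    fix C assume "C \<in> ?S"
    then have "finite C" "C \<noteq> {}" by auto
    then have "0 < card C" by (simp add: card_gt_0_iff)
    then show "1 \<le> enat (card C)" by (simp add: one_enat_def)
  qed
qed

lemma box_dim_quotient_singleton:
  "\<forall>\<^sub>F r in at_right 0. elog (ereal_of_enat (covering_number line {a} r)) / ereal (- ln r) = 0"
proof -
  have "elog (ereal_of_enat 1) = 0"
    unfolding one_enat_def elog_def by simp
  then show ?thesis
    using eventually_at_right_less[of 0]
    by (auto elim!: eventually_mono simp: covering_number_singleton)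
qed

lemma lower_box_dim_singleton: "lower_box_dim line {a} = 0"
  unfolding lower_box_dim_def using tendsto_eventually[OF box_dim_quotient_singleton]
  by (intro lim_imp_Liminf) auto

lemma upper_box_dim_singleton: "upper_box_dim line {a} = 0"
  unfolding upper_box_dim_def using tendsto_eventually[OF box_dim_quotient_singleton]
  by (intro lim_imp_Limsup) auto

text \<open>The line is not totally bounded, so all its covering numbers are infinite. The infimum that turns
  \<open>box_dim\<close> into a dimension of measures therefore runs over a non-empty family for every measure.\<close>
lemma lower_box_dim_UNIV: "lower_box_dim line UNIV = \<infinity>"
proof -
  have *: "covering_number line UNIV r = \<infinity>" if "0 < r" for r
  proof (cases "covering_number line UNIV r")
    case (enat n)
    then show ?thesis using emeasure_closure_le_covering_number[OF enat that] by (simp add: top_unique)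
  qed
  have "\<forall>\<^sub>F r in at_right 0. elog (ereal_of_enat (covering_number line UNIV r)) / ereal (- ln r) = \<infinity>"
    using eventually_at_right_less[of 0] eventually_at_right_real[of 0 1, simplified]
    by eventually_elim (auto simp: * elog_def ereal_divide)
  then show ?thesis
    unfolding lower_box_dim_def by (intro lim_imp_Liminf) (auto intro: tendsto_eventually)
qed

lemma box_dim_UNIV: "box_dim line UNIV = Some \<infinity>"
  using lower_le_upper_box_dim[of line UNIV] by (simp add: box_dim_def lower_box_dim_UNIV)

text \<open>In a countable cover of a set of positive length, the closure of some member has positive length.
  Stating the bound for the box dimension with closures allows for members that are not
  measurable.\<close>
lemma lower_mbox_dim_ge_1:
  assumes "0 < emeasure lborel A"
  shows "1 \<le> lower_mbox_dim line A"
  unfolding lower_mbox_dim_def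
proof (rule INF_greatest)
  fix E assume "E \<in> bounded_covers line A"
  then have "emeasure lborel A \<le> (\<Sum>i. emeasure lborel (closure (E i)))"
    by (intro emeasure_le_suminf_closure) (simp add: bounded_covers_def)
  with assms have "\<not> (\<forall>i. emeasure lborel (closure (E i)) = 0)"
    by (intro notI) simp
  then obtain i where "0 < emeasure lborel (closure (E i))"
    using not_gr_zero by blast
  then show "1 \<le> (SUP i. lower_box_dim line (E i))"
    by (intro SUP_upper2[of i] lower_box_dim_ge_1) auto
qed

lemma lower_le_upper_mbox_dim: "lower_mbox_dim m A \<le> upper_mbox_dim m A"
  unfolding lower_mbox_dim_def upper_mbox_dim_def
  by (rule INF_superset_mono[OF order_refl], rule SUP_subset_mono[OF order_refl])
    (rule lower_le_upper_box_dim)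

lemma upper_mbox_dim_singleton: "upper_mbox_dim line {a} \<le> 0"
proof -
  have "(\<lambda>_. {a}) \<in> bounded_covers line {a}"
    by (simp add: bounded_covers_def)
  then show ?thesis
    unfolding upper_mbox_dim_def by (rule INF_lower2) (simp add: upper_box_dim_singleton)
qed

section \<open>Hausdorff dimension\<close>

lemma le_powr_self:
  fixes x s :: real
  assumes "0 \<le> x" "x \<le> 1" "0 < s" "s \<le> 1"
  shows "x \<le> x powr s"
proof (cases "x = 0")
  case False
  then have "x powr 1 \<le> x powr s" using assms by (intro powr_mono') auto
  then show ?thesis using False assms by simp
qed (use assms in simp)

text \<open>For \<open>s \<le> 1\<close> and diameters at most 1, \<open>d \<le> d powr s\<close>, so length is bounded by the sums that define
  the Hausdorff content.\<close>
lemma emeasure_le_hausdorff_measure: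
  assumes "0 < s" "s \<le> 1"
  shows "emeasure lborel A \<le> hausdorff_measure line s A"
proof -
  have "emeasure lborel A \<le> hausdorff_content line s 1 A"
    unfolding hausdorff_content_def
  proof (rule INF_greatest)
    fix U :: "nat \<Rightarrow> real set"
    assume "U \<in> {U. (\<forall>i. U i \<subseteq> mspace line \<and> ediam line (U i) \<le> ennreal 1) \<and> A \<subseteq> (\<Union>i. U i)}"
    then have U: "\<And>i. ediam line (U i) \<le> 1" "A \<subseteq> (\<Union>i. U i)" by auto
    have "emeasure lborel (closure (U i)) \<le> ennreal (enn2real (ediam line (U i)) powr s)" for i
    proof -
      obtain d where d: "ediam line (U i) = ennreal d" "0 \<le> d" "d \<le> 1"
        using U(1)[of i] by (cases "ediam line (U i)") (auto simp: top_unique)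
      have "emeasure lborel (closure (U i)) \<le> ennreal d"
        using emeasure_closure_le_ediam[of "U i"] d by simp
      also have "\<dots> \<le> ennreal (d powr s)"
        using d assms by (intro ennreal_leI le_powr_self)
      finally show ?thesis using d by simp
    qed
    then show "emeasure lborel A \<le> (\<Sum>i. ennreal (enn2real (ediam line (U i)) powr s))"
      by (intro order_trans[OF emeasure_le_suminf_closure[OF U(2)]] suminf_le) auto
  qed
  also have "\<dots> \<le> hausdorff_measure line s A"
    unfolding hausdorff_measure_def by (rule SUP_upper) simp
  finally show ?thesis .
qed

lemma hausdorff_dim_ge_1:
  assumes "0 < emeasure lborel A"
  shows "1 \<le> hausdorff_dim line A"
  unfolding hausdorff_dim_def
proof (rule INF_greatest)
  fix s assume "s \<in> {s. 0 < s \<and> hausdorff_measure line s A = 0}"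
  then show "1 \<le> ereal s"
    using emeasure_le_hausdorff_measure[of s A] assms by (cases "s \<le> 1") auto
qed

lemma INF_positive_ereal_le_0:
  assumes "\<And>s. 0 < s \<Longrightarrow> P s"
  shows "(INF s\<in>{s. 0 < s \<and> P s}. ereal s) \<le> 0"
proof (rule ereal_le_epsilon2)
  show "(INF s\<in>{s. 0 < s \<and> P s}. ereal s) \<le> 0 + ereal e" if "0 < e" for e
    using assms that by (auto intro!: INF_lower)
qed

lemma hausdorff_dim_singleton: "hausdorff_dim line {a} \<le> 0"
  unfolding hausdorff_dim_def
proof (rule INF_positive_ereal_le_0)
  fix s :: real assume "0 < s"
  have "hausdorff_content line s \<delta> {a} \<le> 0" for \<delta>
    unfolding hausdorff_content_def
    by (rule INF_lower2[of "\<lambda>_. {a}"]) (auto simp: ediam_def)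
  then show "hausdorff_measure line s {a} = 0"
    by (auto simp: hausdorff_measure_def)
qed

section \<open>Packing dimension\<close>

lemma le_2_mult_ennreal:
  fixes x y :: ennreal
  assumes "x / 2 \<le> y"
  shows "x \<le> 2 * y"
proof -
  have "2 * (x / 2) \<le> 2 * y"
    using assms by (rule mult_left_mono) simp
  moreover have "2 * (x / 2) = x"
    using ennreal_mult_divide_eq[of 2 x] by (simp add: ennreal_times_divide mult.commute[of 2])
  ultimately show ?thesis by simp
qed

text \<open>A packing by balls of one radius \<open>\<delta>\<close> with as many balls as possible yields a cover of \<open>E\<close> by balls
  of radius \<open>2 * \<delta>\<close>, for otherwise a further ball would fit. This cover has length at most twice the sum
  of the diameters in the packing. If the number of balls has no maximum, the
  supremum over packings is infinite.\<close>
lemma emeasure_closure_le_packing_premeasure: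
  assumes "0 < s" "s \<le> 1"
  shows "emeasure lborel (closure E) \<le> 2 * packing_premeasure line s E"
proof -
  let ?\<sigma> = "\<lambda>\<delta>. SUP C\<in>packings line \<delta> E. \<Sum>(x, r)\<in>C. ennreal ((2 * r) powr s)"
  have *: "emeasure lborel (closure E) / 2 \<le> ?\<sigma> \<delta>'" if "0 < \<delta>'" for \<delta>'
  proof -
    \<comment> \<open>radius at most \<open>1/2\<close>, so that \<open>2 * \<delta> \<le> (2 * \<delta>) powr s\<close>\<close>
    define \<delta> where "\<delta> = min \<delta>' (1/2)"
    have \<delta>: "0 < \<delta>" "\<delta> \<le> \<delta>'" "2 * \<delta> \<le> 1" using that by (auto simp: \<delta>_def)
    define P where "P F \<longleftrightarrow> finite F \<and> F \<subseteq> E \<and> pairwise (\<lambda>x y. 2 * \<delta> < dist x y) F" for F :: "real set"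
    have card_le: "ennreal (real (card F) * (2 * \<delta>)) \<le> ?\<sigma> \<delta>'" if "P F" for F
    proof -
      have inj: "inj_on (\<lambda>x. (x, \<delta>)) F" by (auto simp: inj_on_def)
      have "disjnt (mcball_of line x \<delta>) (mcball_of line y \<delta>)" if "2 * \<delta> < dist x y" for x y
        using that by (auto simp: disjnt_def dist_real_def)
      then have "(\<lambda>x. (x, \<delta>)) ` F \<in> packings line \<delta>' E"
        using \<open>P F\<close> \<delta> by (auto simp: packings_def P_def pairwise_def)
      then have "(\<Sum>(x, r)\<in>(\<lambda>x. (x, \<delta>)) ` F. ennreal ((2 * r) powr s)) \<le> ?\<sigma> \<delta>'"
        by (rule SUP_upper)
      then have "ennreal (real (card F) * (2 * \<delta>) powr s) \<le> ?\<sigma> \<delta>'"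
        by (simp add: sum.reindex[OF inj] ennreal_mult ennreal_of_nat_eq_real_of_nat)
      moreover have "real (card F) * (2 * \<delta>) \<le> real (card F) * (2 * \<delta>) powr s"
        using \<delta> assms by (intro mult_left_mono le_powr_self) auto
      ultimately show ?thesis by (meson ennreal_leI order_trans)
    qed
    show ?thesis
    proof (cases "?\<sigma> \<delta>'")
      case (real c)
      have bound: "card F < Suc (nat \<lceil>c / (2 * \<delta>)\<rceil>)" if "P F" for F
      proof -
        have "real (card F) * (2 * \<delta>) \<le> c"
          using card_le[OF that] real by simp
        then have "real (card F) \<le> c / (2 * \<delta>)" using \<delta> by (simp add: field_simps)
        then show ?thesis by linarith
      qed
      have "P {}" by (simp add: P_def)
      then obtain F where F: "P F" and max: "\<And>G. P G \<Longrightarrow> card G \<le> card F"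
        using ex_has_greatest_nat[of P "{}" card "Suc (nat \<lceil>c / (2 * \<delta>)\<rceil>)"] bound by auto
      have cover: "E \<subseteq> (\<Union>x\<in>F. cball x (2 * \<delta>))"
      proof (rule subsetI, rule ccontr)
        fix y assume y: "y \<in> E" "y \<notin> (\<Union>x\<in>F. cball x (2 * \<delta>))"
        then have "P (insert y F)" "y \<notin> F"
          using F \<delta> by (auto simp: P_def pairwise_insert dist_commute)
        then show False using max[of "insert y F"] F by (simp add: P_def)
      qed
      have "finite F" using F by (simp add: P_def)
      have "closure E \<subseteq> (\<Union>x\<in>F. cball x (2 * \<delta>))"
        using cover \<open>finite F\<close> by (intro closure_minimal) auto
      then have "emeasure lborel (closure E) \<le> emeasure lborel (\<Union>x\<in>F. cball x (2 * \<delta>))"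
        using \<open>finite F\<close> by (intro emeasure_mono) auto
      also have "\<dots> \<le> (\<Sum>x\<in>F. emeasure lborel (cball x (2 * \<delta>)))"
        using \<open>finite F\<close> by (intro emeasure_subadditive_finite) auto
      also have "\<dots> = (\<Sum>x\<in>F. ennreal (4 * \<delta>))"
        using \<delta> by (intro sum.cong) (auto simp: cball_eq_atLeastAtMost)
      also have "\<dots> = 2 * ennreal (real (card F) * (2 * \<delta>))"
        using \<delta> by (simp add: ennreal_of_nat_eq_real_of_nat flip: ennreal_mult ennreal_numeral)
      also have "\<dots> \<le> 2 * ?\<sigma> \<delta>'"
        using card_le[OF F] by (rule mult_left_mono) simp
      finally show ?thesis by (simp add: divide_le_posI_ennreal mult.commute)
    next
      case top
      then show ?thesis by (simp only: top top_greatest)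
    qed
  qed
  have "emeasure lborel (closure E) / 2 \<le> packing_premeasure line s E"
    unfolding packing_premeasure_def using * by (intro INF_greatest) auto
  then show ?thesis by (rule le_2_mult_ennreal)
qed

lemma emeasure_le_packing_measure:
  assumes "0 < s" "s \<le> 1"
  shows "emeasure lborel A \<le> 2 * packing_measure line s A"
proof -
  have "emeasure lborel A / 2 \<le> packing_measure line s A"
    unfolding packing_measure_def
  proof (rule INF_greatest)
    fix E :: "nat \<Rightarrow> real set"
    assume "E \<in> {E. (\<forall>i. E i \<subseteq> mspace line) \<and> A \<subseteq> (\<Union>i. E i)}"
    then have "emeasure lborel A \<le> (\<Sum>i. emeasure lborel (closure (E i)))"
      by (intro emeasure_le_suminf_closure) simp
    also have "\<dots> \<le> (\<Sum>i. 2 * packing_premeasure line s (E i))"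
      using assms by (intro suminf_le emeasure_closure_le_packing_premeasure) auto
    also have "\<dots> = 2 * (\<Sum>i. packing_premeasure line s (E i))" by simp
    finally show "emeasure lborel A / 2 \<le> (\<Sum>i. packing_premeasure line s (E i))"
      by (simp add: divide_le_posI_ennreal mult.commute)
  qed
  then show ?thesis by (rule le_2_mult_ennreal)
qed

lemma packing_dim_ge_1:
  assumes "0 < emeasure lborel A"
  shows "1 \<le> packing_dim line A"
  unfolding packing_dim_def
proof (rule INF_greatest)
  fix s assume "s \<in> {s. 0 < s \<and> packing_measure line s A = 0}"
  then show "1 \<le> ereal s"
    using emeasure_le_packing_measure[of s A] assms by (cases "s \<le> 1") auto
qed

text \<open>All balls in a packing of \<open>{a}\<close> contain \<open>a\<close>, so there is at most one.\<close>
lemma packing_premeasure_singleton: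
  assumes "0 < s"
  shows "packing_premeasure line s {a} = 0"
proof -
  have sum_le: "(\<Sum>(x, r)\<in>C. ennreal ((2 * r) powr s)) \<le> ennreal ((2 * \<delta>) powr s)"
    if C: "C \<in> packings line \<delta> {a}" for C \<delta>
  proof (cases "C = {}")
    case False
    have centre: "\<exists>q. p = (a, q) \<and> 0 < q \<and> q \<le> \<delta>" if "p \<in> C" for p
    proof -
      have "p \<in> {a} \<times> {0<..\<delta>}" using that C unfolding packings_def by blast
      then show ?thesis by auto
    qed
    from False obtain r where r: "(a, r) \<in> C" "0 < r" "r \<le> \<delta>"
      using centre by blast
    have "p = (a, r)" if "p \<in> C" for p
    proof (rule ccontr)
      assume "p \<noteq> (a, r)"
      moreover have "pairwise (\<lambda>(x, r) (y, t). disjnt (mcball_of line x r) (mcball_of line y t)) C"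
        using C unfolding packings_def by blast
      ultimately have "(\<lambda>(x, r) (y, t). disjnt (mcball_of line x r) (mcball_of line y t)) p (a, r)"
        using pairwiseD(1) that r(1) by metis
      moreover obtain q where q: "p = (a, q)" "0 < q"
        using centre[OF \<open>p \<in> C\<close>] by blast
      ultimately have "disjnt (mcball_of line a q) (mcball_of line a r)"
        by simp
      moreover have "a \<in> mcball_of line a q \<inter> mcball_of line a r"
        using q r by simp
      ultimately show False unfolding disjnt_def by blast
    qed
    then have "C = {(a, r)}" using r(1) by blast
    then show ?thesis using r assms by (auto intro!: ennreal_leI powr_mono2)
  qed simp
  have "packing_premeasure line s {a} \<le> ennreal e" if "0 < e" for e
  proof -
    \<comment> \<open>the radius for which \<open>(2 * \<delta>) powr s = e\<close>\<close>
    define \<delta> where "\<delta> = e powr (1 / s) / 2"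
    have "0 < \<delta>" using that by (simp add: \<delta>_def)
    then have "packing_premeasure line s {a}
        \<le> (SUP C\<in>packings line \<delta> {a}. \<Sum>(x, r)\<in>C. ennreal ((2 * r) powr s))"
      unfolding packing_premeasure_def by (intro INF_lower) simp
    also have "\<dots> \<le> ennreal ((2 * \<delta>) powr s)"
      by (rule SUP_least) (rule sum_le)
    also have "(2 * \<delta>) powr s = e"
      using that assms by (simp add: \<delta>_def powr_powr)
    finally show ?thesis .
  qed
  then have "packing_premeasure line s {a} \<le> 0 + ennreal e" if "0 < e" for e
    using that by simp
  then have "packing_premeasure line s {a} \<le> 0"
    using ennreal_le_epsilon by blast
  then show ?thesis by simp
qed

lemma packing_dim_singleton: "packing_dim line {a} \<le> 0"
  unfolding packing_dim_def
proof (rule INF_positive_ereal_le_0)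
  fix s :: real assume "0 < s"
  then have "packing_measure line s {a} \<le> 0"
    unfolding packing_measure_def
    by (intro INF_lower2[of "\<lambda>_. {a}"]) (auto simp: packing_premeasure_singleton)
  then show "packing_measure line s {a} = 0" by simp
qed

section \<open>Moving part of the length of the unit interval to a point\<close>

definition collapse :: "real \<Rightarrow> real \<Rightarrow> real" where
  "collapse t x = (if x \<le> t then 0 else x)"

text \<open>Length on \<open>[0, 1]\<close> with its part on \<open>[0, t]\<close> moved to the point 0, that is, an atom of mass \<open>t\<close> at 0
  together with length on \<open>]t, 1]\<close>. As an image measure this is countably additive without further
  proof, and it has total mass 1 for all \<open>t\<close>.\<close>
definition collapsed :: "real \<Rightarrow> real measure" where
  "collapsed t = distr (restrict_space lborel {0..1}) borel (collapse t)"

lemma measurable_collapse [measurable]: "collapse t \<in> borel_measurable borel"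
  unfolding collapse_def[abs_def] by measurable

lemma measurable_collapse_restrict:
  "collapse t \<in> measurable (restrict_space lborel {0..1}) borel"
  by (intro measurable_restrict_space1) simp

lemma sets_collapsed [simp, measurable_cong]: "sets (collapsed t) = sets borel"
  and space_collapsed [simp]: "space (collapsed t) = UNIV"
  by (simp_all add: collapsed_def)

lemma emeasure_collapsed:
  assumes "A \<in> sets borel"
  shows "emeasure (collapsed t) A = emeasure lborel (collapse t -` A \<inter> {0..1})"
  using assms unfolding collapsed_def
  by (simp add: emeasure_distr[OF measurable_collapse_restrict] space_restrict_space
      emeasure_restrict_space)

lemma emeasure_collapsed_UNIV [simp]: "emeasure (collapsed t) UNIV = 1"
  by (simp add: emeasure_collapsed)

lemma finite_measure_collapsed: "finite_measure (collapsed t)"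
  by (rule finite_measureI) simp

lemma collapsed_in_borel_measures [simp]: "collapsed t \<in> borel_measures line"
  by (simp add: borel_measures_def finite_measure_collapsed)

lemma measure_collapsed_singleton_0:
  assumes "0 \<le> t" "t \<le> 1"
  shows "measure (collapsed t) {0} = t"
proof -
  have "collapse t -` {0} \<inter> {0..1} = {0..t}"
    using assms by (auto simp: collapse_def split: if_splits)
  then show ?thesis
    using assms by (simp add: measure_def emeasure_collapsed)
qed

lemma emeasure_collapsed_singleton_0:
  assumes "0 \<le> t" "t \<le> 1"
  shows "emeasure (collapsed t) {0} = ennreal t"
  using measure_collapsed_singleton_0[OF assms] finite_measure.emeasure_eq_measure[OF finite_measure_collapsed]
  by metis

lemma integrable_collapsed:
  fixes f :: "real \<Rightarrow> real"
  assumes "f \<in> borel_measurable borel" "\<And>x. \<bar>f x\<bar> \<le> K"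
  shows "integrable (collapsed t) f"
  using assms by (intro finite_measure.integrable_const_bound[OF finite_measure_collapsed]) auto

text \<open>The maps \<open>collapse s\<close> and \<open>collapse t\<close> differ only between \<open>s\<close> and \<open>t\<close>. With continuous, measurable
  and indicator functions for \<open>f\<close>, this estimate gives continuity in the three topologies.\<close>
lemma integral_collapsed_Lipschitz:
  fixes f :: "real \<Rightarrow> real"
  assumes [measurable]: "f \<in> borel_measurable borel" and K: "\<And>x. \<bar>f x\<bar> \<le> K"
  shows "\<bar>(LINT x|collapsed s. f x) - (LINT x|collapsed t. f x)\<bar> \<le> 2 * K * \<bar>s - t\<bar>"
proof -
  let ?U = "restrict_space lborel {0..1::real}"
  interpret finite_measure ?U
    by (rule finite_measureI) (simp add: space_restrict_space emeasure_restrict_space)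
  have int: "integrable ?U (\<lambda>x. f (collapse r x))" for r
    using K by (intro integrable_const_bound[of _ K] AE_I2 measurable_restrict_space1) auto
  have K0: "0 \<le> K" using K[of 0] by linarith
  have le: "\<bar>f (collapse s x) - f (collapse t x)\<bar> \<le> 2 * K * indicator {min s t<..max s t} x" for x
    using K[of 0] K[of x] by (auto simp: collapse_def indicator_def split: if_splits)
  have eq: "(LINT x|collapsed r. f x) = (LINT x|?U. f (collapse r x))" for r
    unfolding collapsed_def by (rule integral_distr[OF measurable_collapse_restrict]) simp
  have "\<bar>(LINT x|collapsed s. f x) - (LINT x|collapsed t. f x)\<bar>
      = \<bar>LINT x|?U. f (collapse s x) - f (collapse t x)\<bar>"
    by (simp add: eq int)
  also have "\<dots> \<le> (LINT x|?U. \<bar>f (collapse s x) - f (collapse t x)\<bar>)"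
    by (rule integral_abs_bound)
  also have "\<dots> = (LINT x|lborel. indicator {0..1} x * \<bar>f (collapse s x) - f (collapse t x)\<bar>)"
    by (simp add: integral_restrict_space)
  also have "\<dots> \<le> (LINT x|lborel. 2 * K * indicator {min s t<..max s t} x)"
  proof (rule integral_mono')
    show "integrable lborel (\<lambda>x. 2 * K * indicator {min s t<..max s t} x)"
      by (intro integrable_mult_right integrable_real_indicator) auto
    show "indicator {0..1} x * \<bar>f (collapse s x) - f (collapse t x)\<bar>
        \<le> 2 * K * indicator {min s t<..max s t} x" for x
      using le[of x] K0 by (auto simp: indicator_def split: if_splits)
  qed (use K0 in auto)
  also have "\<dots> = 2 * K * \<bar>s - t\<bar>" by (simp add: max_def min_def)
  finally show ?thesis .
qed

text \<open>The weak and the setwise topology differ only in the class \<open>\<F>\<close> of test functions. With the zero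
  function in \<open>\<F>\<close>, the subbasic sets cover all measures.\<close>
lemma continuous_map_integral_nbhds:
  assumes "\<F> \<subseteq> {f. f \<in> borel_measurable borel \<and> bounded (range f)}" "(\<lambda>_. 0) \<in> \<F>"
  shows "continuous_map euclideanreal
     (topology_generated_by {integral_nbhd line \<nu> \<epsilon> f | \<nu> \<epsilon> f. \<nu> \<in> borel_measures line \<and> 0 < \<epsilon> \<and> f \<in> \<F>})
     collapsed"
proof (rule continuous_on_generated_topo)
  let ?S = "{integral_nbhd line \<nu> \<epsilon> f | \<nu> \<epsilon> f. \<nu> \<in> borel_measures line \<and> 0 < \<epsilon> \<and> f \<in> \<F>}"
  show "collapsed ` topspace euclideanreal \<subseteq> \<Union>?S"
  proof
    fix \<rho> assume "\<rho> \<in> collapsed ` topspace euclideanreal"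
    then have "\<rho> \<in> integral_nbhd line (collapsed 0) 1 (\<lambda>_. 0)"
      by (auto simp: integral_nbhd_def)
    moreover have "integral_nbhd line (collapsed 0) 1 (\<lambda>_. 0) \<in> ?S"
      using assms(2) collapsed_in_borel_measures[of 0] zero_less_one by blast
    ultimately show "\<rho> \<in> \<Union>?S" by blast
  qed
next
  fix V assume "V \<in> {integral_nbhd line \<nu> \<epsilon> f | \<nu> \<epsilon> f. \<nu> \<in> borel_measures line \<and> 0 < \<epsilon> \<and> f \<in> \<F>}"
  then obtain \<nu> \<epsilon> f where V: "V = integral_nbhd line \<nu> \<epsilon> f" and "f \<in> \<F>" by auto
  then have f: "f \<in> borel_measurable borel" "bounded (range f)" using assms(1) by auto
  then obtain K where K: "\<And>x. \<bar>f x\<bar> \<le> K" by (auto simp: bounded_iff)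
  define c where "c = (LINT x|\<nu>. f x)"
  define g where "g t = (LINT x|collapsed t. f x)" for t
  have "(2 * K)-lipschitz_on UNIV g"
    using integral_collapsed_Lipschitz[OF f(1) K] K[of 0]
    by (intro lipschitz_onI) (auto simp: g_def dist_real_def)
  then have "continuous_on UNIV g" by (rule lipschitz_on_continuous_on)
  then have "open {t. \<bar>g t - c\<bar> < \<epsilon>}"
    by (intro open_Collect_less continuous_intros)
  also have "{t. \<bar>g t - c\<bar> < \<epsilon>} = collapsed -` V \<inter> topspace euclideanreal"
    by (auto simp: V integral_nbhd_def g_def c_def)
  finally show "openin euclideanreal (collapsed -` V \<inter> topspace euclideanreal)" by simp
qed

lemma borel_measurable_metric_borel_line [simp]:
  "borel_measurable (metric_borel line) = borel_measurable borel"
  by (rule measurable_cong_sets) simp_all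

lemma continuous_map_collapsed_setwise: "continuous_map euclideanreal (setwise_topology line) collapsed"
  using continuous_map_integral_nbhds[of "{f. f \<in> borel_measurable borel \<and> bounded (range f)}"]
  by (auto simp: setwise_topology_def)

lemma continuous_map_collapsed_weak: "continuous_map euclideanreal (weak_topology line) collapsed"
  using continuous_map_integral_nbhds[of "{f. continuous_on UNIV f \<and> bounded (range f)}"]
  by (auto simp: weak_topology_def intro: borel_measurable_continuous_onI)

lemma tv_dist_collapsed: "tv_dist line (collapsed s) (collapsed t) \<le> 2 * \<bar>s - t\<bar>"
proof (rule tv_dist_least)
  fix A assume "A \<in> sets (metric_borel line)"
  then have "\<bar>(LINT x|collapsed s. indicator A x) - (LINT x|collapsed t. indicator A x)\<bar> \<le> 2 * 1 * \<bar>s - t\<bar>"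
    by (intro integral_collapsed_Lipschitz) (auto simp: indicator_def)
  then show "\<bar>measure (collapsed s) A - measure (collapsed t) A\<bar> \<le> 2 * \<bar>s - t\<bar>"
    by simp
qed auto

lemma continuous_map_collapsed_tv: "continuous_map euclideanreal (tv_topology line) collapsed"
proof -
  interpret TV: Metric_space "borel_measures line" "tv_dist line"
    by (rule Metric_space_tv_dist)
  show ?thesis
    unfolding tv_topology_def TV.continuous_map_to_metric
  proof (intro ballI allI impI)
    fix t \<epsilon> :: real assume "0 < \<epsilon>"
    have "collapsed s \<in> TV.mball (collapsed t) \<epsilon>" if "s \<in> ball t (\<epsilon> / 2)" for s
      using that tv_dist_collapsed[of t s] by (auto simp: TV.in_mball dist_real_def)
    then show "\<exists>U. openin euclideanreal U \<and> t \<in> U \<and> (\<forall>s\<in>U. collapsed s \<in> TV.mball (collapsed t) \<epsilon>)"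
      using \<open>0 < \<epsilon>\<close> by (intro exI[of _ "ball t (\<epsilon> / 2)"]) auto
  qed
qed

section \<open>Dimensions that jump along the path\<close>

text \<open>The values skip the interval \<open>]0, 1[\<close>. Where in \<open>[0, 1]\<close> the jump occurs is left open, since it is at
  \<open>t = 0\<close> for some dimensions and at \<open>t = 1\<close> for others.\<close>
definition jumps_along_collapsed ::
  "(real metric \<Rightarrow> real measure \<Rightarrow> ereal option) \<Rightarrow> bool" where
  "jumps_along_collapsed D \<longleftrightarrow>
     (\<forall>t. 0 \<le> t \<and> t \<le> 1 \<longrightarrow> (\<exists>v. D line (collapsed t) = Some v \<and>
        (v \<le> 0 \<or> 1 \<le> v) \<and> (t = 0 \<longrightarrow> 1 \<le> v) \<and> (t = 1 \<longrightarrow> v \<le> 0)))"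

lemma jumps_along_collapsedI:
  assumes "\<And>t. 0 \<le> t \<Longrightarrow> t \<le> 1 \<Longrightarrow> \<exists>v. D line (collapsed t) = Some v \<and>
      (v \<le> 0 \<or> 1 \<le> v) \<and> (t = 0 \<longrightarrow> 1 \<le> v) \<and> (t = 1 \<longrightarrow> v \<le> 0)"
  shows "jumps_along_collapsed D"
  using assms by (simp add: jumps_along_collapsed_def)

text \<open>If \<open>D\<close> were continuous, its composition with \<open>collapsed\<close> would be a continuous function on \<open>[0, 1]\<close>,
  which the intermediate value theorem forces to take the value \<open>1/2\<close>.\<close>
lemma jumps_along_collapsed_imp_discontinuous:
  assumes T: "T \<in> {weak_topology, setwise_topology, tv_topology}"
    and jumps: "jumps_along_collapsed D"
  shows "\<not> continuous_map (subtopology (T line) (dim_domain D line)) euclidean (\<lambda>\<nu>. the (D line \<nu>))"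
proof
  assume cont: "continuous_map (subtopology (T line) (dim_domain D line)) euclidean (\<lambda>\<nu>. the (D line \<nu>))"
  note D = jumps[unfolded jumps_along_collapsed_def, rule_format, OF conjI]
  define h where "h t = the (D line (collapsed t))" for t
  have h: "h t \<le> 0 \<or> 1 \<le> h t" "t = 0 \<longrightarrow> 1 \<le> h t" "t = 1 \<longrightarrow> h t \<le> 0" if "0 \<le> t" "t \<le> 1" for t
    using D[OF that] by (auto simp: h_def)
  have "continuous_map euclideanreal (T line) collapsed"
    using T continuous_map_collapsed_weak continuous_map_collapsed_setwise
      continuous_map_collapsed_tv by auto
  moreover have "collapsed \<in> {0..1} \<rightarrow> dim_domain D line"
    using D by (fastforce simp: dim_domain_def)
  ultimately have "continuous_map (top_of_set {0..1}) (subtopology (T line) (dim_domain D line)) collapsed"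
    by (auto simp: continuous_map_in_subtopology intro: continuous_map_from_subtopology)
  from continuous_map_compose[OF this cont] have "continuous_on {0..1} h"
    by (simp add: h_def comp_def)
  moreover have "h 1 \<le> ereal (1/2)" "ereal (1/2) \<le> h 0"
    using h(2)[of 0] h(3)[of 1] order_trans[of "h 1" 0 "ereal (1/2)"]
      order_trans[of "ereal (1/2)" 1 "h 0"] by simp_all
  ultimately obtain t where "0 \<le> t" "t \<le> 1" "h t = ereal (1/2)"
    using IVT2'[of h 1 "ereal (1/2)" 0] by auto
  then show False using h(1)[of t] by auto
qed

section \<open>Dimensions of measures induced by dimensions of sets\<close>

text \<open>A value at \<open>UNIV\<close> makes the induced dimensions of measures defined everywhere.\<close>
definition separates_point_from_length :: "(real metric \<Rightarrow> real set \<Rightarrow> ereal option) \<Rightarrow> bool" where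
  "separates_point_from_length dm \<longleftrightarrow>
     (\<exists>v. dm line {0} = Some v \<and> v \<le> 0) \<and> dm line UNIV \<noteq> None \<and>
     (\<forall>A v. A \<in> sets borel \<longrightarrow> 0 < emeasure lborel A \<longrightarrow> dm line A = Some v \<longrightarrow> 1 \<le> v)"

lemma lborel_pos_if_collapsed_pos:
  assumes "A \<in> sets borel" "0 < emeasure (collapsed 0) A"
  shows "0 < emeasure lborel A"
proof -
  have "collapse 0 -` A \<inter> {0..1} \<subseteq> A" by (auto simp: collapse_def split: if_splits)
  then have "emeasure (collapsed 0) A \<le> emeasure lborel A"
    using assms(1) by (simp add: emeasure_collapsed emeasure_mono)
  with assms(2) show ?thesis by (rule less_le_trans)
qed

lemma lborel_pos_if_collapsed_full:
  assumes "A \<in> sets borel" "emeasure (collapsed t) (UNIV - A) = 0" "0 \<le> t" "t < 1"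
  shows "0 < emeasure lborel A"
proof (rule ccontr)
  assume "\<not> 0 < emeasure lborel A"
  then have "A \<in> null_sets lborel" using assms(1) by auto
  moreover have "collapse t -` (UNIV - A) \<inter> {0..1} \<in> null_sets lborel"
    using assms(1,2) measurable_sets[OF measurable_collapse, of "UNIV - A" t]
    by (auto simp: null_sets_def emeasure_collapsed)
  ultimately have "A \<union> (collapse t -` (UNIV - A) \<inter> {0..1}) \<in> null_sets lborel" by blast
  moreover have "{t<..1} \<subseteq> A \<union> (collapse t -` (UNIV - A) \<inter> {0..1})"
    using assms(3) by (auto simp: collapse_def)
  ultimately have "{t<..1} \<in> null_sets lborel"
    using null_sets_subset[of _ lborel "{t<..1}"] by simp
  then show False using assms(4) by (auto simp: null_sets_def)
qed

text \<open>As soon as \<open>t > 0\<close>, the atom makes \<open>{0}\<close> a set of positive measure, which brings the infimum down to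
  0. For \<open>t = 0\<close> all sets of positive measure have positive length.\<close>
lemma jumps_lower_measure_dim:
  assumes dm: "separates_point_from_length dm"
  shows "jumps_along_collapsed (lower_measure_dim dm)"
proof (rule jumps_along_collapsedI)
  fix t :: real assume t: "0 \<le> t" "t \<le> 1"
  let ?S = "{v. \<exists>A\<in>sets (metric_borel line). 0 < emeasure (collapsed t) A \<and> dm line A = Some v}"
  obtain u where "dm line UNIV = Some u"
    using dm by (auto simp: separates_point_from_length_def)
  then have "u \<in> ?S" by (auto intro!: bexI[of _ UNIV])
  then have "?S \<noteq> {}" by blast
  then have val: "lower_measure_dim dm line (collapsed t) = Some (Inf ?S)"
    unfolding lower_measure_dim_def inf_option_def by (rule if_not_P)
  show "\<exists>v. lower_measure_dim dm line (collapsed t) = Some v \<and>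
      (v \<le> 0 \<or> 1 \<le> v) \<and> (t = 0 \<longrightarrow> 1 \<le> v) \<and> (t = 1 \<longrightarrow> v \<le> 0)"
  proof (cases "t = 0")
    case True
    have "1 \<le> Inf ?S"
      using dm lborel_pos_if_collapsed_pos True
      by (intro Inf_greatest) (auto simp: separates_point_from_length_def)
    then show ?thesis using val True by auto
  next
    case False
    obtain v where v: "dm line {0} = Some v" "v \<le> 0"
      using dm by (auto simp: separates_point_from_length_def)
    moreover have "0 < emeasure (collapsed t) {0}"
      using t False by (simp add: emeasure_collapsed_singleton_0)
    ultimately have "v \<in> ?S" by (auto intro!: bexI[of _ "{0}"])
    then have "Inf ?S \<le> 0" using v(2) by (rule Inf_lower2)
    then show ?thesis using val False by auto
  qed
qed

text \<open>As long as \<open>t < 1\<close>, a set that carries the measure must contain almost all of \<open>]t, 1]\<close>. For \<open>t = 1\<close>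
  the measure is carried by \<open>{0}\<close>.\<close>
lemma jumps_upper_measure_dim:
  assumes dm: "separates_point_from_length dm"
  shows "jumps_along_collapsed (upper_measure_dim dm)"
proof (rule jumps_along_collapsedI)
  fix t :: real assume t: "0 \<le> t" "t \<le> 1"
  let ?S = "{v. \<exists>A\<in>sets (metric_borel line).
      emeasure (collapsed t) (mspace line - A) = 0 \<and> dm line A = Some v}"
  obtain u where "dm line UNIV = Some u"
    using dm by (auto simp: separates_point_from_length_def)
  then have "u \<in> ?S" by (auto intro!: bexI[of _ UNIV])
  then have "?S \<noteq> {}" by blast
  then have val: "upper_measure_dim dm line (collapsed t) = Some (Inf ?S)"
    unfolding upper_measure_dim_def inf_option_def by (rule if_not_P)
  show "\<exists>v. upper_measure_dim dm line (collapsed t) = Some v \<and>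
      (v \<le> 0 \<or> 1 \<le> v) \<and> (t = 0 \<longrightarrow> 1 \<le> v) \<and> (t = 1 \<longrightarrow> v \<le> 0)"
  proof (cases "t = 1")
    case False
    have "1 \<le> Inf ?S"
      using dm lborel_pos_if_collapsed_full t False
      by (intro Inf_greatest) (auto simp: separates_point_from_length_def)
    then show ?thesis using val False by auto
  next
    case True
    obtain v where v: "dm line {0} = Some v" "v \<le> 0"
      using dm by (auto simp: separates_point_from_length_def)
    moreover have "emeasure (collapsed t) (UNIV - {0}) = 0"
      using t True emeasure_compl[of "{0}" "collapsed t"] by (simp add: emeasure_collapsed_singleton_0)
    ultimately have "v \<in> ?S" by (auto intro!: bexI[of _ "{0}"])
    then have "Inf ?S \<le> 0" using v(2) by (rule Inf_lower2)
    then show ?thesis using val True by auto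
  qed
qed

lemma emeasure_closure_pos: "0 < emeasure lborel A \<Longrightarrow> 0 < emeasure lborel (closure A)"
  by (erule less_le_trans) (intro emeasure_mono closure_subset, simp)

lemma separates_everywhereI:
  assumes "dm line {0} \<le> 0" "\<And>A. 0 < emeasure lborel A \<Longrightarrow> 1 \<le> dm line A"
  shows "separates_point_from_length (everywhere dm)"
  using assms by (auto simp: separates_point_from_length_def everywhere_def)

lemma separates_set_dimensions:
  "separates_point_from_length box_dim"
  "separates_point_from_length (everywhere upper_box_dim)"
  "separates_point_from_length (everywhere lower_box_dim)"
  "separates_point_from_length (everywhere upper_mbox_dim)"
  "separates_point_from_length (everywhere lower_mbox_dim)"
  "separates_point_from_length (everywhere hausdorff_dim)"
  "separates_point_from_length (everywhere packing_dim)"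
proof -
  have lower: "1 \<le> lower_box_dim line A" if "0 < emeasure lborel A" for A
    using that by (intro lower_box_dim_ge_1 emeasure_closure_pos)
  then have upper: "1 \<le> upper_box_dim line A" if "0 < emeasure lborel A" for A
    using that lower_le_upper_box_dim order_trans by blast
  show "separates_point_from_length box_dim"
    unfolding separates_point_from_length_def
    by (auto simp: box_dim_UNIV)
      (auto simp: box_dim_def lower_box_dim_singleton upper_box_dim_singleton lower split: if_splits)
  show "separates_point_from_length (everywhere upper_box_dim)"
    "separates_point_from_length (everywhere lower_box_dim)"
    using upper lower
    by (auto intro!: separates_everywhereI simp: lower_box_dim_singleton upper_box_dim_singleton)
  show "separates_point_from_length (everywhere upper_mbox_dim)"
    "separates_point_from_length (everywhere lower_mbox_dim)"
    by (intro separates_everywhereI; meson lower_mbox_dim_ge_1 lower_le_upper_mbox_dim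
        upper_mbox_dim_singleton order_trans)+
  show "separates_point_from_length (everywhere hausdorff_dim)"
    "separates_point_from_length (everywhere packing_dim)"
    by (intro separates_everywhereI hausdorff_dim_ge_1 packing_dim_ge_1
        hausdorff_dim_singleton packing_dim_singleton; assumption)+
qed

section \<open>Correlation dimensions\<close>

lemma lim_option_eqI:
  assumes "(g \<longlongrightarrow> l) (at_right 0)"
  shows "lim_option g = Some l"
  using assms tendsto_Lim[OF _ assms] by (auto simp: lim_option_def)

text \<open>Constant factors do not matter, because their logarithms vanish relative to \<open>ln r\<close>.\<close>
lemma lim_option_elog_quotient:
  fixes I :: "real \<Rightarrow> real"
  assumes "0 < c" "0 < C"
    and "\<forall>\<^sub>F r in at_right 0. c * r powr k \<le> I r \<and> I r \<le> C * r powr k"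
  shows "lim_option (\<lambda>r. elog (ereal (I r)) / ereal (ln r)) = Some (ereal k)"
proof (rule lim_option_eqI)
  have lim: "((\<lambda>r. k + ln b / ln r) \<longlongrightarrow> k + 0) (at_right (0::real))" for b :: real
    by (intro tendsto_add tendsto_const tendsto_divide_0[OF tendsto_const]
          filterlim_at_bot_imp_at_infinity ln_at_0)
  have bounds: "\<forall>\<^sub>F r in at_right 0. 0 < I r \<and> r < 1 \<and> 0 < r \<and>
      k + ln C / ln r \<le> ln (I r) / ln r \<and> ln (I r) / ln r \<le> k + ln c / ln r"
    using assms(3) eventually_at_right_less[of 0] eventually_at_right_real[of 0 1, simplified]
  proof eventually_elim
    case (elim r)
    then have r: "0 < r" "r < 1" "ln r < 0" by auto
    have "0 < c * r powr k" using assms r by simp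
    then have pos: "0 < I r" using elim by linarith
    have "ln (c * r powr k) \<le> ln (I r)" "ln (I r) \<le> ln (C * r powr k)"
      using elim pos \<open>0 < c * r powr k\<close> assms(2) r by (auto intro!: ln_le_cancel_iff[THEN iffD2])
    then have "ln c + k * ln r \<le> ln (I r)" "ln (I r) \<le> ln C + k * ln r"
      using assms r by (simp_all add: ln_mult ln_powr)
    then have "(ln C + k * ln r) / ln r \<le> ln (I r) / ln r" "ln (I r) / ln r \<le> (ln c + k * ln r) / ln r"
      using r by (auto intro!: divide_right_mono_neg)
    then show ?case using pos r by (simp add: add_divide_distrib add.commute)
  qed
  have "((\<lambda>r. ln (I r) / ln r) \<longlongrightarrow> k) (at_right 0)"
    by (rule tendsto_sandwich[OF _ _ lim[of C, simplified] lim[of c, simplified]])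
       (use bounds in \<open>auto elim: eventually_mono\<close>)
  then have "((\<lambda>r. ereal (ln (I r) / ln r)) \<longlongrightarrow> ereal k) (at_right 0)" by simp
  then show "((\<lambda>r. elog (ereal (I r)) / ereal (ln r)) \<longlongrightarrow> ereal k) (at_right 0)"
    by (rule Lim_transform_eventually) (use bounds in \<open>auto elim!: eventually_mono simp: elog_def\<close>)
qed

lemma mball_of_line: "mball_of line x r = ball x r"
  by (auto simp: ball_def)

lemma measurable_measure_ball [measurable]:
  "(\<lambda>x. measure (collapsed t) (ball x r)) \<in> borel_measurable borel"
proof -
  interpret finite_measure "collapsed t" by (rule finite_measure_collapsed)
  have "{p. dist (fst p) (snd p) < r} \<in> sets (borel \<Otimes>\<^sub>M borel :: (real \<times> real) measure)"
    unfolding borel_prod by (intro borel_open open_Collect_less continuous_intros)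
  also have "sets (borel \<Otimes>\<^sub>M borel :: (real \<times> real) measure) = sets (borel \<Otimes>\<^sub>M collapsed t)"
    by (intro sets_pair_measure_cong) simp_all
  finally have "(\<lambda>x. emeasure (collapsed t) (Pair x -` {p. dist (fst p) (snd p) < r})) \<in> borel_measurable borel"
    by (rule measurable_emeasure_Pair)
  moreover have "Pair x -` {p. dist (fst p) (snd p) < r} = ball x r" for x :: real
    by (auto simp: ball_def)
  ultimately have "(\<lambda>x. emeasure (collapsed t) (ball x r)) \<in> borel_measurable borel"
    by (simp only:)
  then show ?thesis unfolding measure_def by measurable
qed

lemma measure_collapsed_le_1: "measure (collapsed t) A \<le> 1"
  using finite_measure.bounded_measure[OF finite_measure_collapsed, of t A]
  by (simp add: measure_def)

lemma corr_dim_on_eqI: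
  assumes A: "A \<in> sets borel" and "0 < c" "0 < C" "0 < \<delta>"
    and lower: "\<And>r. 0 < r \<Longrightarrow> r < \<delta> \<Longrightarrow> c * r powr k \<le> (LINT x:A|collapsed t. measure (collapsed t) (ball x r))"
    and upper: "\<And>r. 0 < r \<Longrightarrow> r < \<delta> \<Longrightarrow> (LINT x:A|collapsed t. measure (collapsed t) (ball x r)) \<le> C * r powr k"
  shows "corr_dim_on line (collapsed t) A = Some (ereal k)"
  unfolding corr_dim_on_def mball_of_line
  using assms(2,3) lower upper eventually_at_right_real[OF assms(4)]
  by (intro lim_option_elog_quotient[of c C]) (auto elim!: eventually_mono)

text \<open>The lower bound may be checked on a subset \<open>B\<close> only: the atom when there is one, and \<open>A \<inter> {0..1}\<close>
  when the measure is length.\<close>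
lemma set_integral_ball_bounds:
  assumes A: "A \<in> sets borel" and B: "B \<in> sets borel" "B \<subseteq> A" and "0 \<le> a" "0 \<le> b"
    and lower: "\<And>x. x \<in> B \<Longrightarrow> a \<le> measure (collapsed t) (ball x r)"
    and upper: "\<And>x. measure (collapsed t) (ball x r) \<le> b"
  shows "a * measure (collapsed t) B \<le> (LINT x:A|collapsed t. measure (collapsed t) (ball x r))"
    and "(LINT x:A|collapsed t. measure (collapsed t) (ball x r)) \<le> b"
proof -
  let ?g = "\<lambda>x. indicator A x * measure (collapsed t) (ball x r)"
  interpret finite_measure "collapsed t" by (rule finite_measure_collapsed)
  have [measurable]: "A \<in> sets borel" "B \<in> sets borel" by fact+
  have int: "integrable (collapsed t) ?g"
    by (intro integrable_collapsed[of _ 1]) (auto simp: indicator_def measure_collapsed_le_1)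
  have "a * measure (collapsed t) B = (LINT x|collapsed t. a * indicator B x)" by simp
  also have "\<dots> \<le> (LINT x|collapsed t. ?g x)"
    using lower B(2) \<open>0 \<le> a\<close>
    by (intro integral_mono int integrable_collapsed[of _ a]) (auto simp: indicator_def)
  finally show "a * measure (collapsed t) B \<le> (LINT x:A|collapsed t. measure (collapsed t) (ball x r))"
    by (simp add: set_lebesgue_integral_def)
  have "(LINT x|collapsed t. ?g x) \<le> (LINT x|collapsed t. b)"
    using upper \<open>0 \<le> b\<close> by (intro integral_mono int) (auto simp: indicator_def)
  also have "\<dots> = b" by (simp add: measure_def)
  finally show "(LINT x:A|collapsed t. measure (collapsed t) (ball x r)) \<le> b"
    by (simp add: set_lebesgue_integral_def)
qed

text \<open>The atom alone contributes \<open>t\<^sup>2\<close> to the integral, so that the integral stays between two positive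
  constants as \<open>r\<close> tends to 0.\<close>
lemma corr_dim_on_atom:
  assumes t: "0 < t" "t \<le> 1" and A: "A \<in> sets borel" "0 \<in> A"
  shows "corr_dim_on line (collapsed t) A = Some 0"
proof -
  interpret finite_measure "collapsed t" by (rule finite_measure_collapsed)
  have ball: "t \<le> measure (collapsed t) (ball 0 r)" if "0 < r" for r
    using that t finite_measure_mono[of "{0}" "ball 0 r"] by (simp add: measure_collapsed_singleton_0)
  have "corr_dim_on line (collapsed t) A = Some (ereal 0)"
  proof (rule corr_dim_on_eqI[OF A(1), where c = "t * t" and C = 1 and \<delta> = 1])
    fix r :: real assume "0 < r" "r < 1"
    then show "t * t * r powr 0 \<le> (LINT x:A|collapsed t. measure (collapsed t) (ball x r))"
      "(LINT x:A|collapsed t. measure (collapsed t) (ball x r)) \<le> 1 * r powr 0"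
      using set_integral_ball_bounds[of A "{0}" t 1 t r] t A ball measure_collapsed_le_1
      by (auto simp: measure_collapsed_singleton_0)
  qed (use t in auto)
  then show ?thesis by (simp add: zero_ereal_def)
qed

lemma measure_collapsed_uniform: "A \<in> sets borel \<Longrightarrow> measure (collapsed 0) A = measure lborel (A \<inter> {0..1})"
  by (auto simp: measure_def emeasure_collapsed collapse_def intro!: arg_cong[where f="\<lambda>X. enn2real (emeasure lborel X)"])

text \<open>Every ball with centre in \<open>[0, 1]\<close> and small radius \<open>r\<close> has length between \<open>r\<close> and \<open>2 * r\<close> inside the
  interval.\<close>
lemma corr_dim_on_uniform:
  assumes A: "A \<in> sets borel" "0 < measure (collapsed 0) A"
  shows "corr_dim_on line (collapsed 0) A = Some 1"
proof -
  let ?a = "measure (collapsed 0) A"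
  let ?B = "A \<inter> {0..1}"
  have B: "measure (collapsed 0) ?B = ?a" "?B \<in> sets borel"
    using A(1) by (simp_all add: measure_collapsed_uniform Int_assoc)
  have upper: "measure (collapsed 0) (ball x r) \<le> 2 * r" if "0 < r" for x r
  proof -
    have "measure lborel (ball x r \<inter> {0..1}) \<le> measure lborel (ball x r)"
      using that by (intro measure_mono_fmeasurable)
        (auto simp: fmeasurable_def ball_eq_greaterThanLessThan)
    then show ?thesis using that by (simp add: measure_collapsed_uniform ball_eq_greaterThanLessThan)
  qed
  have lower: "r \<le> measure (collapsed 0) (ball x r)" if "0 < r" "r < 1/2" "x \<in> {0..1}" for x r
  proof -
    \<comment> \<open>the half of the ball on the side of \<open>x\<close> that stays inside \<open>[0, 1]\<close>\<close>
    define y where "y = (if x \<le> 1/2 then x else x - r)"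
    have "{y<..<y + r} \<subseteq> ball x r \<inter> {0..1}"
      using that by (auto simp: y_def dist_real_def)
    moreover have "emeasure lborel (ball x r \<inter> {0..1}) \<le> emeasure lborel {0..1::real}"
      by (intro emeasure_mono) auto
    then have "ball x r \<inter> {0..1} \<in> fmeasurable lborel"
      using le_less_trans[of _ "1::ennreal" top] by (simp add: fmeasurable_def)
    ultimately have "measure lborel {y<..<y + r} \<le> measure lborel (ball x r \<inter> {0..1})"
      by (intro measure_mono_fmeasurable) simp_all
    then show ?thesis using that by (simp add: measure_collapsed_uniform)
  qed
  have "corr_dim_on line (collapsed 0) A = Some (ereal 1)"
  proof (rule corr_dim_on_eqI[OF A(1), where c = "?a" and C = 2 and \<delta> = "1/2"])
    fix r :: real assume "0 < r" "r < 1/2"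
    then show "?a * r powr 1 \<le> (LINT x:A|collapsed 0. measure (collapsed 0) (ball x r))"
      "(LINT x:A|collapsed 0. measure (collapsed 0) (ball x r)) \<le> 2 * r powr 1"
      using set_integral_ball_bounds[of A ?B r "2 * r" 0 r] A B lower upper
      by (auto simp: mult.commute)
  qed (use A in auto)
  then show ?thesis by (simp add: one_ereal_def)
qed

lemma jumps_corr_dim: "jumps_along_collapsed corr_dim"
proof (rule jumps_along_collapsedI)
  fix t :: real assume t: "0 \<le> t" "t \<le> 1"
  show "\<exists>v. corr_dim line (collapsed t) = Some v \<and>
      (v \<le> 0 \<or> 1 \<le> v) \<and> (t = 0 \<longrightarrow> 1 \<le> v) \<and> (t = 1 \<longrightarrow> v \<le> 0)"
  proof (cases "t = 0")
    case True
    then have "corr_dim line (collapsed t) = Some 1"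
      unfolding corr_dim_def using corr_dim_on_uniform[of UNIV] by (simp add: measure_def)
    then show ?thesis using True by simp
  next
    case False
    then have "corr_dim line (collapsed t) = Some 0"
      unfolding corr_dim_def using corr_dim_on_atom[of t UNIV] t by simp
    then show ?thesis using False by simp
  qed
qed

lemma mod_corr_dim_eqI:
  assumes "0 < \<epsilon>" "\<And>\<delta>. 0 < \<delta> \<Longrightarrow> \<delta> < \<epsilon> \<Longrightarrow> large_sets m \<nu> \<delta> \<noteq> {}"
    and "\<And>\<delta> A. 0 < \<delta> \<Longrightarrow> \<delta> < \<epsilon> \<Longrightarrow> A \<in> large_sets m \<nu> \<delta> \<Longrightarrow> corr_dim_on m \<nu> A = Some k"
  shows "mod_corr_dim m \<nu> = Some k"
proof -
  have "\<forall>\<^sub>F \<delta> in at_right 0. large_sets m \<nu> \<delta> \<noteq> {} \<and> (\<forall>A\<in>large_sets m \<nu> \<delta>. corr_dim_on m \<nu> A \<noteq> None)"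
    using eventually_at_right_real[OF assms(1)] by eventually_elim (use assms in auto)
  moreover have "\<forall>\<^sub>F \<delta> in at_right 0. (SUP A\<in>large_sets m \<nu> \<delta>. the (corr_dim_on m \<nu> A)) = k"
    using eventually_at_right_real[OF assms(1)] by eventually_elim (use assms in auto)
  ultimately show ?thesis
    unfolding mod_corr_dim_def by (simp add: lim_option_eqI tendsto_eventually)
qed

text \<open>For \<open>\<delta> < t\<close> the complement of an admissible set has measure less than \<open>t\<close> and cannot contain the
  atom. This rests on the total mass 1: if an atom of mass \<open>t\<close> were added to length instead of
  replacing part of it, then \<open>]0, 1]\<close> would be admissible for all \<open>\<delta>\<close>.\<close>
lemma jumps_mod_corr_dim: "jumps_along_collapsed mod_corr_dim"
proof (rule jumps_along_collapsedI)
  fix t :: real assume t: "0 \<le> t" "t \<le> 1"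
  interpret finite_measure "collapsed t" by (rule finite_measure_collapsed)
  have UNIV: "UNIV \<in> large_sets line (collapsed t) \<delta>" if "0 < \<delta>" for \<delta>
    using that by (simp add: large_sets_def measure_def)
  show "\<exists>v. mod_corr_dim line (collapsed t) = Some v \<and>
      (v \<le> 0 \<or> 1 \<le> v) \<and> (t = 0 \<longrightarrow> 1 \<le> v) \<and> (t = 1 \<longrightarrow> v \<le> 0)"
  proof (cases "t = 0")
    case True
    have "mod_corr_dim line (collapsed t) = Some 1"
    proof (rule mod_corr_dim_eqI[of 1])
      fix \<delta> :: real and A assume "0 < \<delta>" "\<delta> < 1" "A \<in> large_sets line (collapsed t) \<delta>"
      then show "corr_dim_on line (collapsed t) A = Some 1"
        using True by (auto simp: large_sets_def intro!: corr_dim_on_uniform)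
    qed (use UNIV in auto)
    then show ?thesis using True by simp
  next
    case False
    have "mod_corr_dim line (collapsed t) = Some 0"
    proof (rule mod_corr_dim_eqI[of t])
      fix \<delta> A assume \<delta>: "0 < \<delta>" "\<delta> < t" and A: "A \<in> large_sets line (collapsed t) \<delta>"
      have "0 \<in> A"
      proof (rule ccontr)
        assume "0 \<notin> A"
        then have "measure (collapsed t) A \<le> measure (collapsed t) (UNIV - {0})"
          by (intro finite_measure_mono) auto
        also have "\<dots> = 1 - t"
          using t finite_measure_compl[of "{0}"] by (simp add: measure_collapsed_singleton_0) (simp add: measure_def)
        finally show False using A \<delta> by (simp add: large_sets_def)
      qed
      then show "corr_dim_on line (collapsed t) A = Some 0"
        using A t False by (intro corr_dim_on_atom) (auto simp: large_sets_def)
    qed (use UNIV t False in auto)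
    then show ?thesis using False by simp
  qed
qed

theorem theorem3p1:
  fixes D :: "real metric \<Rightarrow> real measure \<Rightarrow> ereal option"
    and T :: "real metric \<Rightarrow> real measure topology"
  assumes "D \<in> {lower_measure_dim box_dim,
                lower_measure_dim (everywhere upper_box_dim),
                lower_measure_dim (everywhere lower_box_dim),
                lower_measure_dim (everywhere upper_mbox_dim),
                lower_measure_dim (everywhere lower_mbox_dim),
                lower_measure_dim (everywhere hausdorff_dim),
                lower_measure_dim (everywhere packing_dim),
                upper_measure_dim box_dim,
                upper_measure_dim (everywhere upper_box_dim),
                upper_measure_dim (everywhere lower_box_dim),
                upper_measure_dim (everywhere upper_mbox_dim),
                upper_measure_dim (everywhere lower_mbox_dim),
                upper_measure_dim (everywhere hausdorff_dim),
                upper_measure_dim (everywhere packing_dim),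
                corr_dim, mod_corr_dim}"
    and "T \<in> {weak_topology, setwise_topology, tv_topology}"
  shows "\<exists>m. \<not> continuous_map (subtopology (T m) (dim_domain D m)) euclidean (\<lambda>\<nu>. the (D m \<nu>))"
proof -
  have "D \<in> {corr_dim, mod_corr_dim} \<or>
      (\<exists>dm. separates_point_from_length dm \<and> D \<in> {lower_measure_dim dm, upper_measure_dim dm})"
    using assms(1) separates_set_dimensions by blast
  then have "jumps_along_collapsed D"
    using jumps_corr_dim jumps_mod_corr_dim jumps_lower_measure_dim jumps_upper_measure_dim
    by auto
  then show ?thesis
    using jumps_along_collapsed_imp_discontinuous[OF assms(2)] by blast
qed

end
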